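(* Let $\mathbb{K}$ be a field of characteristic $2$ and let $(A,\cdot,\{-,-\},(-)^{\{2\}})$ be a unital restricted Poisson algebra whose module of Kähler differentials $\Omega^1(A)$ is free as an $A$-module. Then there is a well-defined map $(-)^{[2]}:\Omega^1(A)\to\Omega^1(A)$ satisfying $(x\,\mathrm{d}u)^{[2]}=x^2\,\mathrm{d}(u^{\{2\}})+x\{u,x\}\,\mathrm{d}u$ for all $x,u\in A$; with it, $(\Omega^1(A),[-,-]_{\Omega^1(A)},(-)^{[2]})$ is a restricted Lie algebra and $(A,\Omega^1(A),\pi^\sharp)$ is a restricted Lie–Rinehart algebra.
   Context: $\mathbb{K}$ has characteristic $2$. A Poisson algebra is a commutative associative $\mathbb{K}$-algebra $(A,\cdot)$ with a Lie bracket $\{-,-\}$ satisfying $\{ab,c\}=a\{b,c\}+b\{a,c\}$. It is a restricted Poisson algebra if there is a map $(-)^{\{2\}}:A\to A$ making $(A,\{-,-\},(-)^{\{2\}})$ a restricted Lie algebra (i.e. $(\lambda x)^{\{2\}}=\lambda^2x^{\{2\}}$, $\mathrm{ad}_{x^{\{2\}}}=\mathrm{ad}_x^2$, $(x+y)^{\{2\}}=x^{\{2\}}+y^{\{2\}}+\{x,y\}$) and $(xy)^{\{2\}}=x^2y^{\{2\}}+y^2x^{\{2\}}+xy\{x,y\}$ for all $x,y$. $\Omega^1(A)$ is the $A$-module generated by symbols $\mathrm{d}x$, $x\in A$, modulo $\mathrm{d}(xy)-x\,\mathrm{d}y-y\,\mathrm{d}x$, $\mathrm{d}(x+y)-\mathrm{d}x-\mathrm{d}y$,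 $\mathrm{d}\lambda$ ($\lambda\in\mathbb{K}$). Its bracket is $[x\,\mathrm{d}u,y\,\mathrm{d}v]_{\Omega^1(A)}=x\{u,y\}\mathrm{d}v+y\{x,v\}\mathrm{d}u+xy\,\mathrm{d}\{u,v\}$, and the anchor $\pi^\sharp:\Omega^1(A)\to\mathrm{Der}(A)$ is $\pi^\sharp(x\,\mathrm{d}u)=x\{u,-\}$. A restricted Lie–Rinehart algebra $(A,L,\theta)$: $L$ a restricted Lie algebra and $A$-module, $\theta:L\to\mathrm{Der}(A)$ an $A$-linear restricted Lie morphism ($\mathrm{Der}(A)$ with commutator and $D^{[2]}=D\circ D$), with $[x,ay]=a[x,y]+\theta(x)(a)y$ and $(ax)^{[2]}=a^2x^{[2]}+\theta(ax)(a)x$. *)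

theory Defs
  imports Main
begin

definition module_on ::
  "'b set \<Rightarrow> ('b \<Rightarrow> 'b \<Rightarrow> 'b) \<Rightarrow> 'b \<Rightarrow> ('b \<Rightarrow> 'b) \<Rightarrow> ('r::comm_ring_1 \<Rightarrow> 'b \<Rightarrow> 'b) \<Rightarrow> bool" where
  "module_on L add zero neg smul \<longleftrightarrow>
     zero \<in> L \<and>
     (\<forall>x\<in>L. \<forall>y\<in>L. add x y \<in> L) \<and>
     (\<forall>x\<in>L. neg x \<in> L) \<and>
     (\<forall>r. \<forall>x\<in>L. smul r x \<in> L) \<and>
     (\<forall>x\<in>L. \<forall>y\<in>L. \<forall>z\<in>L. add (add x y) z = add x (add y z)) \<and>
     (\<forall>x\<in>L. \<forall>y\<in>L. add x y = add y x) \<and>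
     (\<forall>x\<in>L. add zero x = x) \<and>
     (\<forall>x\<in>L. add (neg x) x = zero) \<and>
     (\<forall>r. \<forall>x\<in>L. \<forall>y\<in>L. smul r (add x y) = add (smul r x) (smul r y)) \<and>
     (\<forall>r s. \<forall>x\<in>L. smul (r + s) x = add (smul r x) (smul s x)) \<and>
     (\<forall>r s. \<forall>x\<in>L. smul (r * s) x = smul r (smul s x)) \<and>
     (\<forall>x\<in>L. smul 1 x = x)"

definition lie_algebra_on ::
  "'b set \<Rightarrow> ('b \<Rightarrow> 'b \<Rightarrow> 'b) \<Rightarrow> 'b \<Rightarrow> ('b \<Rightarrow> 'b) \<Rightarrow> ('k::field \<Rightarrow> 'b \<Rightarrow> 'b)
     \<Rightarrow> ('b \<Rightarrow> 'b \<Rightarrow> 'b) \<Rightarrow> bool" where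
  "lie_algebra_on L add zero neg smul br \<longleftrightarrow>
     module_on L add zero neg smul \<and>
     (\<forall>x\<in>L. \<forall>y\<in>L. br x y \<in> L) \<and>
     (\<forall>x\<in>L. \<forall>y\<in>L. \<forall>z\<in>L. br (add x y) z = add (br x z) (br y z)) \<and>
     (\<forall>x\<in>L. \<forall>y\<in>L. \<forall>z\<in>L. br x (add y z) = add (br x y) (br x z)) \<and>
     (\<forall>c. \<forall>x\<in>L. \<forall>y\<in>L. br (smul c x) y = smul c (br x y)) \<and>
     (\<forall>c. \<forall>x\<in>L. \<forall>y\<in>L. br x (smul c y) = smul c (br x y)) \<and>
     (\<forall>x\<in>L. br x x = zero) \<and>
     (\<forall>x\<in>L. \<forall>y\<in>L. \<forall>z\<in>L.
        add (br x (br y z)) (add (br y (br z x)) (br z (br x y))) = zero)"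

definition restricted_lie_algebra_on ::
  "'b set \<Rightarrow> ('b \<Rightarrow> 'b \<Rightarrow> 'b) \<Rightarrow> 'b \<Rightarrow> ('b \<Rightarrow> 'b) \<Rightarrow> ('k::field \<Rightarrow> 'b \<Rightarrow> 'b)
     \<Rightarrow> ('b \<Rightarrow> 'b \<Rightarrow> 'b) \<Rightarrow> ('b \<Rightarrow> 'b) \<Rightarrow> bool" where
  "restricted_lie_algebra_on L add zero neg smul br sq \<longleftrightarrow>
     lie_algebra_on L add zero neg smul br \<and>
     (\<forall>x\<in>L. sq x \<in> L) \<and>
     (\<forall>c. \<forall>x\<in>L. sq (smul c x) = smul (c * c) (sq x)) \<and>
     (\<forall>x\<in>L. \<forall>y\<in>L. br (sq x) y = br x (br x y)) \<and>
     (\<forall>x\<in>L. \<forall>y\<in>L. sq (add x y) = add (add (sq x) (sq y)) (br x y))"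

text \<open>A unital commutative associative K-algebra is a commutative ring 'a together with
  a unital ring homomorphism \<iota> : K \<rightarrow> A; the scalar action is c\<cdot>a = \<iota> c * a.\<close>
definition k_algebra :: "('k::field \<Rightarrow> 'a::comm_ring_1) \<Rightarrow> bool" where
  "k_algebra \<iota> \<longleftrightarrow> \<iota> 1 = 1 \<and> (\<forall>a b. \<iota> (a + b) = \<iota> a + \<iota> b) \<and> (\<forall>a b. \<iota> (a * b) = \<iota> a * \<iota> b)"

definition restricted_poisson_algebra ::
  "('k::field \<Rightarrow> 'a::comm_ring_1) \<Rightarrow> ('a \<Rightarrow> 'a \<Rightarrow> 'a) \<Rightarrow> ('a \<Rightarrow> 'a) \<Rightarrow> bool" where
  "restricted_poisson_algebra \<iota> P S \<longleftrightarrow>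
     k_algebra \<iota> \<and>
     restricted_lie_algebra_on (UNIV :: 'a set) (+) 0 uminus (\<lambda>c a. \<iota> c * a) P S \<and>
     (\<forall>a b c. P (a * b) c = a * P b c + b * P a c) \<and>
     (\<forall>x y. S (x * y) = x^2 * S y + y^2 * S x + x * y * P x y)"

definition is_derivation :: "('k::field \<Rightarrow> 'a::comm_ring_1) \<Rightarrow> ('a \<Rightarrow> 'a) \<Rightarrow> bool" where
  "is_derivation \<iota> D \<longleftrightarrow>
     (\<forall>a b. D (a + b) = D a + D b) \<and> (\<forall>c a. D (\<iota> c * a) = \<iota> c * D a) \<and>
     (\<forall>a b. D (a * b) = a * D b + b * D a)"

definition restricted_lie_rinehart ::
  "('k::field \<Rightarrow> 'a::comm_ring_1) \<Rightarrow> 'b set \<Rightarrow> ('b \<Rightarrow> 'b \<Rightarrow> 'b) \<Rightarrow> 'b \<Rightarrow> ('b \<Rightarrow> 'b)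
     \<Rightarrow> ('a \<Rightarrow> 'b \<Rightarrow> 'b) \<Rightarrow> ('b \<Rightarrow> 'b \<Rightarrow> 'b) \<Rightarrow> ('b \<Rightarrow> 'b) \<Rightarrow> ('b \<Rightarrow> 'a \<Rightarrow> 'a) \<Rightarrow> bool" where
  "restricted_lie_rinehart \<iota> L add zero neg amul br sq \<theta> \<longleftrightarrow>
     module_on L add zero neg amul \<and>
     restricted_lie_algebra_on L add zero neg (\<lambda>c x. amul (\<iota> c) x) br sq \<and>
     (\<forall>x\<in>L. is_derivation \<iota> (\<theta> x)) \<and>
     (\<forall>x\<in>L. \<forall>y\<in>L. \<theta> (add x y) = (\<lambda>a. \<theta> x a + \<theta> y a)) \<and>
     (\<forall>b. \<forall>x\<in>L. \<theta> (amul b x) = (\<lambda>a. b * \<theta> x a)) \<and>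
     (\<forall>x\<in>L. \<forall>y\<in>L. \<theta> (br x y) = (\<lambda>a. \<theta> x (\<theta> y a) - \<theta> y (\<theta> x a))) \<and>
     (\<forall>x\<in>L. \<theta> (sq x) = \<theta> x \<circ> \<theta> x) \<and>
     (\<forall>a. \<forall>x\<in>L. \<forall>y\<in>L. br x (amul a y) = add (amul a (br x y)) (amul (\<theta> x a) y)) \<and>
     (\<forall>a. \<forall>x\<in>L. sq (amul a x) = add (amul (a * a) (sq x)) (amul (\<theta> (amul a x) a) x))"

text \<open>The free A-module on symbols du (u \<in> A): finitely supported f : A \<Rightarrow> A,
  representing \<Sum>_u f(u) du.  gen x u represents x du.\<close>
definition fsupp :: "('a \<Rightarrow> 'a::zero) \<Rightarrow> bool" where
  "fsupp f \<longleftrightarrow> finite {u. f u \<noteq> 0}"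

definition gen :: "'a::zero \<Rightarrow> 'a \<Rightarrow> 'a \<Rightarrow> 'a" where
  "gen x u = (\<lambda>v. if v = u then x else 0)"

inductive_set kahler_rel :: "('k::field \<Rightarrow> 'a::comm_ring_1) \<Rightarrow> ('a \<Rightarrow> 'a) set" for \<iota> where
  rel_mult: "(\<lambda>v. gen 1 (x * y) v - gen x y v - gen y x v) \<in> kahler_rel \<iota>"
| rel_add: "(\<lambda>v. gen 1 (x + y) v - gen 1 x v - gen 1 y v) \<in> kahler_rel \<iota>"
| rel_scalar: "gen 1 (\<iota> c) \<in> kahler_rel \<iota>"
| rel_zero: "(\<lambda>v. 0) \<in> kahler_rel \<iota>"
| rel_plus: "f \<in> kahler_rel \<iota> \<Longrightarrow> g \<in> kahler_rel \<iota> \<Longrightarrow> (\<lambda>v. f v + g v) \<in> kahler_rel \<iota>"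
| rel_smul: "f \<in> kahler_rel \<iota> \<Longrightarrow> (\<lambda>v. a * f v) \<in> kahler_rel \<iota>"

definition kcls :: "('k::field \<Rightarrow> 'a::comm_ring_1) \<Rightarrow> ('a \<Rightarrow> 'a) \<Rightarrow> ('a \<Rightarrow> 'a) set" where
  "kcls \<iota> f = {g. fsupp g \<and> (\<lambda>v. f v - g v) \<in> kahler_rel \<iota>}"

definition Omega1 :: "('k::field \<Rightarrow> 'a::comm_ring_1) \<Rightarrow> ('a \<Rightarrow> 'a) set set" where
  "Omega1 \<iota> = kcls \<iota> ` {f. fsupp f}"

definition krep :: "('a \<Rightarrow> 'a) set \<Rightarrow> ('a \<Rightarrow> 'a)" where
  "krep X = (SOME f. f \<in> X)"

definition odiff :: "('k::field \<Rightarrow> 'a::comm_ring_1) \<Rightarrow> 'a \<Rightarrow> 'a \<Rightarrow> ('a \<Rightarrow> 'a) set" where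
  "odiff \<iota> x u = kcls \<iota> (gen x u)"

definition oadd :: "('k::field \<Rightarrow> 'a::comm_ring_1) \<Rightarrow> ('a \<Rightarrow> 'a) set \<Rightarrow> ('a \<Rightarrow> 'a) set \<Rightarrow> ('a \<Rightarrow> 'a) set" where
  "oadd \<iota> X Y = kcls \<iota> (\<lambda>v. krep X v + krep Y v)"

definition ozero :: "('k::field \<Rightarrow> 'a::comm_ring_1) \<Rightarrow> ('a \<Rightarrow> 'a) set" where
  "ozero \<iota> = kcls \<iota> (\<lambda>v. 0)"

definition oneg :: "('k::field \<Rightarrow> 'a::comm_ring_1) \<Rightarrow> ('a \<Rightarrow> 'a) set \<Rightarrow> ('a \<Rightarrow> 'a) set" where
  "oneg \<iota> X = kcls \<iota> (\<lambda>v. - krep X v)"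

definition osmul :: "('k::field \<Rightarrow> 'a::comm_ring_1) \<Rightarrow> 'a \<Rightarrow> ('a \<Rightarrow> 'a) set \<Rightarrow> ('a \<Rightarrow> 'a) set" where
  "osmul \<iota> a X = kcls \<iota> (\<lambda>v. a * krep X v)"

definition br_gen :: "('a::comm_ring_1 \<Rightarrow> 'a \<Rightarrow> 'a) \<Rightarrow> 'a \<Rightarrow> 'a \<Rightarrow> 'a \<Rightarrow> 'a \<Rightarrow> 'a \<Rightarrow> 'a" where
  "br_gen P x u y v = (\<lambda>w. gen (x * P u y) v w + gen (y * P x v) u w + gen (x * y) (P u v) w)"

definition obr :: "('k::field \<Rightarrow> 'a::comm_ring_1) \<Rightarrow> ('a \<Rightarrow> 'a \<Rightarrow> 'a)
    \<Rightarrow> ('a \<Rightarrow> 'a) set \<Rightarrow> ('a \<Rightarrow> 'a) set \<Rightarrow> ('a \<Rightarrow> 'a) set" where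
  "obr \<iota> P X Y = kcls \<iota> (\<lambda>w. \<Sum>u\<in>{u. krep X u \<noteq> 0}. \<Sum>v\<in>{v. krep Y v \<noteq> 0}.
       br_gen P (krep X u) u (krep Y v) v w)"

definition anchor :: "('a::comm_ring_1 \<Rightarrow> 'a \<Rightarrow> 'a) \<Rightarrow> ('a \<Rightarrow> 'a) set \<Rightarrow> 'a \<Rightarrow> 'a" where
  "anchor P X = (\<lambda>a. \<Sum>u\<in>{u. krep X u \<noteq> 0}. krep X u * P u a)"

definition omega_lincomb :: "('k::field \<Rightarrow> 'a::comm_ring_1) \<Rightarrow> (('a \<Rightarrow> 'a) set \<Rightarrow> 'a) \<Rightarrow> ('a \<Rightarrow> 'a) set" where
  "omega_lincomb \<iota> c = kcls \<iota> (\<lambda>v. \<Sum>b\<in>{b. c b \<noteq> 0}. c b * krep b v)"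

definition Omega1_free :: "('k::field \<Rightarrow> 'a::comm_ring_1) \<Rightarrow> bool" where
  "Omega1_free \<iota> \<longleftrightarrow> (\<exists>B \<subseteq> Omega1 \<iota>. \<forall>X\<in>Omega1 \<iota>.
     \<exists>!c. (\<forall>b. b \<notin> B \<longrightarrow> c b = 0) \<and> finite {b. c b \<noteq> 0} \<and> X = omega_lincomb \<iota> c)"

end

theory Submission
  imports Complex_Main Defs "HOL-Library.Function_Algebras"
begin

text \<open>On the free module \<open>F\<close> over the symbols \<open>du\<close>, set
  \<open>Q(\<Sum> x\<^sub>i du\<^sub>i) = \<Sum> (x\<^sub>i\<^sup>2 d(S u\<^sub>i) + x\<^sub>i P(u\<^sub>i, x\<^sub>i) du\<^sub>i) + \<Sum>\<^bsub>i<j\<^esub> [x\<^sub>i du\<^sub>i, x\<^sub>j du\<^sub>j]\<close>.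
  Modulo the submodule \<open>R\<close> of Kaehler relations,
  \<open>Q(f + g) = Q f + Q g + [f, g]\<close> and \<open>Q(a f) = a\<^sup>2 Q f + \<theta>(a f)(a) f\<close>, where \<open>\<theta>\<close> is the anchor.
  Hence \<open>Q\<close> descends to \<open>F/R\<close> as soon as it kills the generators of \<open>R\<close>, which follows from the
  formulas for \<open>S\<close> of sums, products and scalars. The other identities hold on all
  elements once they hold on generators \<open>x du\<close>, because both sides have the same polarization.
  To calculate modulo \<open>R\<close> by equational reasoning, \<open>F/R\<close> is embedded into \<open>F\<close> by a
  linear map \<open>p\<close> with kernel \<open>R\<close>.\<close>

section \<open>Embedding the quotient by the Kaehler relations\<close>

text \<open>Over the field, the subspace \<open>kahler_rel \<iota>\<close> has a complement, and
  \<open>p\<close> is the projection onto it. The complement need not be an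
  \<open>A\<close>-submodule, so \<open>p\<close> need not commute with multiplication by elements
  of \<open>A\<close>.\<close>

lemma exists_projection_with_kernel_kahler_rel:
  fixes \<iota> :: "'k::field \<Rightarrow> 'a::comm_ring_1"
  assumes "k_algebra \<iota>"
  shows "\<exists>p :: ('a \<Rightarrow> 'a) \<Rightarrow> 'a \<Rightarrow> 'a.
    (\<forall>f g. p (f + g) = p f + p g) \<and> (\<forall>f. p f = 0 \<longleftrightarrow> f \<in> kahler_rel \<iota>)"
proof -
  let ?s = "\<lambda>(c::'k) (f :: 'a \<Rightarrow> 'a) v. \<iota> c * f v"
  interpret V: vector_space ?s
    using assms by unfold_locales (auto simp: k_algebra_def fun_eq_iff algebra_simps)
  interpret VV: vector_space_pair ?s ?s ..
  have R: "V.subspace (kahler_rel \<iota>)"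
    unfolding V.subspace_def
    using kahler_rel.rel_zero[of \<iota>] kahler_rel.rel_plus[of _ \<iota>] kahler_rel.rel_smul[of _ \<iota>]
    by (auto simp: plus_fun_def zero_fun_def)
  obtain B where B: "B \<subseteq> kahler_rel \<iota>" "V.independent B" "kahler_rel \<iota> \<subseteq> V.span B"
    using V.basis_exists by metis
  have spanB: "V.span B = kahler_rel \<iota>"
    using B R by (simp add: V.span_minimal subset_antisym)
  define E where "E = V.extend_basis B"
  have E: "B \<subseteq> E" "V.independent E" "V.span E = UNIV"
    unfolding E_def using B
    by (auto simp: V.extend_basis_superset V.independent_extend_basis)
  \<comment> \<open>\<open>p\<close> kills the basis \<open>B\<close> of the relations and fixes the
    remaining vectors of the extended basis \<open>E\<close>.\<close>
  obtain p where p: "Vector_Spaces.linear ?s ?s p" "\<And>x. x \<in> E \<Longrightarrow> p x = (if x \<in> B then 0 else x)"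
    using VV.linear_independent_extend[OF E(2), of "\<lambda>x. if x \<in> B then 0 else x"] by metis
  have pB: "p x = 0" if "x \<in> V.span B" for x
  proof (rule VV.linear_eq_0_on_span[OF p(1) _ that])
    show "p b = 0" if "b \<in> B" for b
      using p(2)[of b] that E(1) by auto
  qed
  have pC: "p x = x" if "x \<in> V.span (E - B)" for x
    using VV.linear_eq_on_span[OF p(1) V.linear_ident _ that] p(2) by auto
  have "x \<in> V.span B" if "p x = 0" for x
  proof -
    have "x \<in> V.span (B \<union> (E - B))"
      using E by (simp add: Un_absorb1)
    then obtain b c where bc: "x = b + c" "b \<in> V.span B" "c \<in> V.span (E - B)"
      unfolding V.span_Un by auto
    then have "p x = c"
      using pB pC VV.linear_add[OF p(1)] by simp
    then show ?thesis using bc that by simp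
  qed
  then show ?thesis
    using pB spanB VV.linear_add[OF p(1)] by blast
qed

section \<open>Finitely supported functions and additive maps out of them\<close>

text \<open>For \<open>\<phi>\<close> additive in its first argument, this is the additive map on
  the free module with \<open>x du \<mapsto> \<phi> x u\<close>.\<close>

definition lin :: "('a::zero \<Rightarrow> 'a \<Rightarrow> 'b::ab_group_add) \<Rightarrow> ('a \<Rightarrow> 'a) \<Rightarrow> 'b" where
  "lin \<phi> f = (\<Sum>u | f u \<noteq> 0. \<phi> (f u) u)"

definition fsm :: "'a::comm_ring_1 \<Rightarrow> ('a \<Rightarrow> 'a) \<Rightarrow> 'a \<Rightarrow> 'a" where
  "fsm a f = (\<lambda>v. a * f v)"

definition additive_coeff :: "('a::comm_ring_1 \<Rightarrow> 'a \<Rightarrow> 'b::ab_group_add) \<Rightarrow> bool" where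
  "additive_coeff \<phi> \<longleftrightarrow> (\<forall>x y u. \<phi> (x + y) u = \<phi> x u + \<phi> y u)"

lemma sum_fun_apply: "(\<Sum>i\<in>I. f i) x = (\<Sum>i\<in>I. f i x)" for f :: "'i \<Rightarrow> 'a \<Rightarrow> 'b::comm_monoid_add"
  by (induction I rule: infinite_finite_induct) auto

lemma fsupp_zero [simp]: "fsupp 0" "fsupp (\<lambda>v. 0)"
  by (simp_all add: fsupp_def)

lemma fsupp_gen [simp]: "fsupp (gen x u)"
  unfolding fsupp_def by (rule finite_subset[of _ "{u}"]) (auto simp: gen_def)

lemma fsupp_add [simp]: "fsupp f \<Longrightarrow> fsupp g \<Longrightarrow> fsupp (f + g)" for f g :: "'a \<Rightarrow> 'a::comm_ring_1"
  unfolding fsupp_def by (rule finite_subset[of _ "{u. f u \<noteq> 0} \<union> {u. g u \<noteq> 0}"]) auto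

lemma fsupp_fsm [simp]: "fsupp f \<Longrightarrow> fsupp (fsm a f)"
  unfolding fsupp_def fsm_def by (rule finite_subset[of _ "{u. f u \<noteq> 0}"]) auto

lemma fsupp_uminus [simp]: "fsupp f \<Longrightarrow> fsupp (- f)" for f :: "'a \<Rightarrow> 'a::comm_ring_1"
  by (simp add: fsupp_def)

lemma fsupp_diff [simp]: "fsupp f \<Longrightarrow> fsupp g \<Longrightarrow> fsupp (f - g)" for f g :: "'a \<Rightarrow> 'a::comm_ring_1"
  using fsupp_add[of f "- g"] by simp

lemma fsupp_sum: "(\<And>i. i \<in> I \<Longrightarrow> fsupp (f i)) \<Longrightarrow> fsupp (\<Sum>i\<in>I. f i)"
  for f :: "'i \<Rightarrow> 'a \<Rightarrow> 'a::comm_ring_1"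
  by (induction I rule: infinite_finite_induct) auto

lemma fsupp_lin: "(\<And>x u. fsupp (\<phi> x u)) \<Longrightarrow> fsupp (lin \<phi> f)"
  for \<phi> :: "'a::comm_ring_1 \<Rightarrow> 'a \<Rightarrow> 'a \<Rightarrow> 'a"
  unfolding lin_def by (rule fsupp_sum)

lemma fsm_zero [simp]: "fsm a 0 = 0"
  by (simp add: fsm_def fun_eq_iff)

lemma fsm_add: "fsm a (f + g) = fsm a f + fsm a g"
  by (simp add: fsm_def fun_eq_iff algebra_simps)

lemma fsm_add_left: "fsm (a + b) f = fsm a f + fsm b f"
  by (simp add: fsm_def fun_eq_iff algebra_simps)

lemma fsm_fsm: "fsm a (fsm b f) = fsm (a * b) f"
  by (simp add: fsm_def fun_eq_iff algebra_simps)

lemma fsm_one [simp]: "fsm 1 f = f"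
  by (simp add: fsm_def)

lemma fsm_gen: "fsm a (gen x u) = gen (a * x) u"
  by (simp add: fsm_def gen_def fun_eq_iff)

lemma fsm_diff: "fsm a (f - g) = fsm a f - fsm a g"
  by (simp add: fsm_def fun_eq_iff algebra_simps)

lemma gen_zero [simp]: "gen 0 u = 0"
  by (simp add: gen_def fun_eq_iff)

lemma gen_add: "gen (x + y) u = gen x u + gen y u" for x y :: "'a::comm_ring_1"
  by (simp add: gen_def fun_eq_iff)

lemma additive_coeff_zero: "additive_coeff \<phi> \<Longrightarrow> \<phi> 0 u = 0"
  unfolding additive_coeff_def by (metis add_cancel_right_right)

text \<open>Lets functions with different supports be summed over one common index set.\<close>

lemma lin_eq_sum:
  assumes "finite U" "\<And>u. f u \<noteq> 0 \<Longrightarrow> u \<in> U" "\<And>u. \<phi> 0 u = 0"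
  shows "lin \<phi> f = (\<Sum>u\<in>U. \<phi> (f u) u)"
  unfolding lin_def using assms by (intro sum.mono_neutral_left) auto

lemma lin_gen: "\<phi> 0 u = 0 \<Longrightarrow> lin \<phi> (gen x u) = \<phi> x u"
  by (cases "x = 0") (auto simp: lin_def gen_def)

lemma lin_add:
  assumes "additive_coeff \<phi>" "fsupp f" "fsupp g"
  shows "lin \<phi> (f + g) = lin \<phi> f + lin \<phi> g"
proof -
  let ?U = "{u. f u \<noteq> 0} \<union> {u. g u \<noteq> 0}"
  have U: "finite ?U" using assms by (simp add: fsupp_def)
  have *: "lin \<phi> h = (\<Sum>u\<in>?U. \<phi> (h u) u)" if "\<And>u. h u \<noteq> 0 \<Longrightarrow> u \<in> ?U" for h
    using lin_eq_sum[OF U that] additive_coeff_zero[OF assms(1)] by blast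
  have "lin \<phi> (f + g) = (\<Sum>u\<in>?U. \<phi> ((f + g) u) u)" by (rule *) auto
  also have "\<dots> = (\<Sum>u\<in>?U. \<phi> (f u) u) + (\<Sum>u\<in>?U. \<phi> (g u) u)"
    using assms(1) by (simp add: additive_coeff_def sum.distrib)
  also have "\<dots> = lin \<phi> f + lin \<phi> g" by (simp add: *)
  finally show ?thesis .
qed

lemma lin_coeff_add: "lin (\<lambda>x u. \<phi> x u + \<psi> x u) f = lin \<phi> f + lin \<psi> f"
  by (simp add: lin_def sum.distrib)

lemma lin_zero_coeff [simp]: "lin (\<lambda>x u. 0) f = 0"
  by (simp add: lin_def)

lemma lin_zero [simp]: "lin \<phi> 0 = 0"
  by (simp add: lin_def)

lemmas fun_apply = plus_fun_apply zero_fun_apply minus_apply uminus_apply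

text \<open>Keeps the simplifier from pushing function arithmetic under an eta-expanded abstraction,
  as such terms are produced by induction over functions.\<close>

declare fun_apply [simp del]

text \<open>The elements \<open>x du\<close> with arbitrary coefficient \<open>x\<close> generate
  the free module as an additive group.\<close>

lemma fsupp_induct [consumes 1, case_names gen add]:
  fixes f :: "'a \<Rightarrow> 'a::comm_ring_1"
  assumes "fsupp f"
    and gen: "\<And>x u. Q (gen x u)"
    and add: "\<And>f g. fsupp f \<Longrightarrow> fsupp g \<Longrightarrow> Q f \<Longrightarrow> Q g \<Longrightarrow> Q (f + g)"
  shows "Q f"
proof -
  have Q0: "Q 0" using gen[of 0] by simp
  have *: "Q (\<Sum>u\<in>U. gen (f u) u)" if "finite U" for U
    using that
  proof (induction U)
    case empty
    show ?case unfolding sum.empty by (rule Q0)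
  next
    case (insert v U)
    show ?case unfolding sum.insert[OF insert.hyps]
      by (intro add gen fsupp_gen fsupp_sum insert.IH)
  qed
  have "f = (\<Sum>u | f u \<noteq> 0. gen (f u) u)"
    using \<open>fsupp f\<close> by (auto simp: fun_eq_iff fun_apply sum_fun_apply gen_def fsupp_def)
  then show ?thesis using *[of "{u. f u \<noteq> 0}"] \<open>fsupp f\<close> by (simp add: fsupp_def)
qed

section \<open>Additive maps vanishing on the Kaehler relations\<close>

lemma kahler_rel_fsupp: "f \<in> kahler_rel \<iota> \<Longrightarrow> fsupp f"
proof (induction rule: kahler_rel.induct)
  case (rel_mult x y)
  show ?case using fsupp_diff[OF fsupp_diff[of "gen 1 (x * y)" "gen x y"], of "gen y x"]
    by (simp add: fun_diff_def)
next
  case (rel_add x y)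
  show ?case using fsupp_diff[OF fsupp_diff[of "gen 1 (x + y)" "gen 1 x"], of "gen 1 y"]
    by (simp add: fun_diff_def)
next
  case (rel_plus f g)
  then show ?case using fsupp_add[of f g] by (simp add: plus_fun_def)
next
  case (rel_smul f a)
  then show ?case using fsupp_fsm[of f a] by (simp add: fsm_def)
qed auto

text \<open>Here \<open>\<phi> x u\<close> is the prescribed image of \<open>x du\<close>; under these conditions the induced
  additive map factors through the Kaehler differentials.\<close>

definition kahler_map :: "('k::field \<Rightarrow> 'a::comm_ring_1) \<Rightarrow> ('a \<Rightarrow> 'a \<Rightarrow> 'b::ab_group_add) \<Rightarrow> bool" where
  "kahler_map \<iota> \<phi> \<longleftrightarrow> additive_coeff \<phi> \<and>
     (\<forall>z x y. \<phi> z (x * y) = \<phi> (z * x) y + \<phi> (z * y) x) \<and>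
     (\<forall>z x y. \<phi> z (x + y) = \<phi> z x + \<phi> z y) \<and>
     (\<forall>z c. \<phi> z (\<iota> c) = 0)"

lemma lin_diff:
  assumes "additive_coeff \<phi>" "fsupp f" "fsupp g"
  shows "lin \<phi> (f - g) = lin \<phi> f - lin \<phi> g"
  using lin_add[OF assms(1) fsupp_diff[OF assms(2,3)] assms(3)] by (simp add: algebra_simps)

lemma lin_kahler_rel:
  assumes "kahler_map \<iota> \<phi>" "f \<in> kahler_rel \<iota>"
  shows "lin \<phi> f = 0"
proof -
  have add: "additive_coeff \<phi>" using assms by (simp add: kahler_map_def)
  note simps = lin_diff[OF add] lin_gen[where \<phi> = \<phi>, OF additive_coeff_zero[OF add]] fsm_diff fsm_gen
  \<comment> \<open>\<open>lin \<phi>\<close> is only additive, so closure of the relations under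
    multiplication is handled by proving the claim for all multiples of \<open>f\<close> at
    once.\<close>
  have "lin \<phi> (fsm a f) = 0" for a
    using assms(2)
  proof (induction arbitrary: a rule: kahler_rel.induct)
    case (rel_mult x y)
    have "(\<lambda>v. gen 1 (x * y) v - gen x y v - gen y x v) = gen 1 (x * y) - gen x y - gen y x"
      by (simp add: fun_eq_iff fun_apply)
    then show ?case using assms(1) by (simp only: simps kahler_map_def fsupp_gen fsupp_diff) simp
  next
    case (rel_add x y)
    have "(\<lambda>v. gen 1 (x + y) v - gen 1 x v - gen 1 y v) = gen 1 (x + y) - gen 1 x - gen 1 y"
      by (simp add: fun_eq_iff fun_apply)
    then show ?case using assms(1) by (simp only: simps kahler_map_def fsupp_gen fsupp_diff) simp
  next
    case (rel_scalar c)
    then show ?case using assms(1) by (simp add: simps kahler_map_def)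
  next
    case rel_zero
    then show ?case by (simp add: lin_def fsm_def)
  next
    case (rel_plus f g)
    then show ?case
      using lin_add[OF add, of "fsm a f" "fsm a g"] kahler_rel_fsupp[of f \<iota>] kahler_rel_fsupp[of g \<iota>]
      by (simp add: fsm_add[symmetric]) (simp add: plus_fun_def)
  next
    case (rel_smul f b)
    then show ?case using rel_smul.IH[of "a * b"] by (simp add: fsm_def mult.assoc)
  qed
  from this[of 1] show ?thesis by simp
qed

section \<open>Bracket, anchor and square on representatives\<close>

definition fbr :: "('a::comm_ring_1 \<Rightarrow> 'a \<Rightarrow> 'a) \<Rightarrow> ('a \<Rightarrow> 'a) \<Rightarrow> ('a \<Rightarrow> 'a) \<Rightarrow> 'a \<Rightarrow> 'a" where
  "fbr P f g = lin (\<lambda>x u. lin (\<lambda>y v. br_gen P x u y v) g) f"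

definition fanc :: "('a::comm_ring_1 \<Rightarrow> 'a \<Rightarrow> 'a) \<Rightarrow> ('a \<Rightarrow> 'a) \<Rightarrow> 'a \<Rightarrow> 'a" where
  "fanc P f a = lin (\<lambda>x u. x * P u a) f"

text \<open>Extends \<open>(x du)^[2]\<close> to sums: the strict total order \<open>r\<close> on the symbols selects each unordered
  pair of summands once.\<close>

definition fsq :: "('a::comm_ring_1 \<Rightarrow> 'a \<Rightarrow> 'a) \<Rightarrow> ('a \<Rightarrow> 'a) \<Rightarrow> ('a \<times> 'a) set \<Rightarrow> ('a \<Rightarrow> 'a) \<Rightarrow> 'a \<Rightarrow> 'a" where
  "fsq P S r f = lin (\<lambda>x u. gen (x\<^sup>2) (S u) + gen (x * P u x) u) f
     + lin (\<lambda>x u. lin (\<lambda>y v. if (u, v) \<in> r then br_gen P x u y v else 0) f) f"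

text \<open>Two auxiliary choices enter as parameters: \<open>p\<close> stands for reduction modulo
  the Kaehler relations, and \<open>r\<close> selects one orientation of each pair of distinct
  symbols.\<close>

locale restricted_poisson_char_2 =
  fixes \<iota> :: "'k::field \<Rightarrow> 'a::comm_ring_1"
    and P :: "'a \<Rightarrow> 'a \<Rightarrow> 'a"
    and S :: "'a \<Rightarrow> 'a"
    and p :: "('a \<Rightarrow> 'a) \<Rightarrow> 'a \<Rightarrow> 'a"
    and r :: "('a \<times> 'a) set"
  assumes char_2: "CHAR('k) = 2"
    and poisson: "restricted_poisson_algebra \<iota> P S"
    and p_add: "p (f + g) = p f + p g"
    and p_eq_0_iff: "p f = 0 \<longleftrightarrow> f \<in> kahler_rel \<iota>"
    and r_irrefl: "(u, u) \<notin> r"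
    and r_total: "u \<noteq> v \<Longrightarrow> (u, v) \<in> r \<longleftrightarrow> (v, u) \<notin> r"
begin

section \<open>Characteristic 2 and the Poisson identities\<close>

lemma iota:
  "\<iota> 1 = 1" "\<iota> (a + b) = \<iota> a + \<iota> b" "\<iota> (a * b) = \<iota> a * \<iota> b"
  using poisson by (auto simp: restricted_poisson_algebra_def k_algebra_def)

lemma iota_0: "\<iota> 0 = 0"
  using iota(2)[of 0 0] by simp

lemma two_eq_0: "(1::'a) + 1 = 0"
proof -
  have "(1::'k) + 1 = of_nat CHAR('k)" by (simp add: char_2)
  then have "(1::'k) + 1 = 0" by (simp only: of_nat_CHAR)
  then show ?thesis using iota(1) iota(2)[of 1 1] iota_0 by simp
qed

lemma add_self: "(x::'a) + x = 0"
  using two_eq_0 by (metis distrib_left mult.right_neutral mult_zero_right)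

lemma add_self_left: "(x::'a) + (x + y) = y"
  by (metis add_self add.assoc add_0)

lemma neg_eq: "- (x::'a) = x"
  using add_self[of x] by (simp add: eq_neg_iff_add_eq_0)

lemma diff_eq: "(x::'a) - y = x + y"
  using neg_eq[of y] by (metis diff_conv_add_uminus)

lemma two_eq_0': "(2::'a) = 0" "(2::'a \<Rightarrow> 'a) = 0"
proof -
  show two: "(2::'a) = 0" using two_eq_0 by (simp only: one_add_one)
  show "(2::'a \<Rightarrow> 'a) = 0" using two by (auto simp: fun_eq_iff zero_fun_apply)
qed

lemma F_add_self: "(f::'a \<Rightarrow> 'a) + f = 0"
  by (simp add: fun_eq_iff fun_apply two_eq_0')

lemma F_add_self_left: "(f::'a \<Rightarrow> 'a) + (f + g) = g"
  by (simp add: fun_eq_iff fun_apply two_eq_0' add_self_left)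

lemma F_neg: "- (f::'a \<Rightarrow> 'a) = f"
  by (simp add: fun_eq_iff fun_apply neg_eq)

lemma F_diff: "(f::'a \<Rightarrow> 'a) - g = f + g"
  by (simp add: fun_eq_iff fun_apply diff_eq)

text \<open>As rewrite rules these turn differences into sums and cancel equal summands, both in
  \<open>A\<close> and in the free module.\<close>

lemmas char2 = two_eq_0' add_self add_self_left neg_eq diff_eq F_add_self F_add_self_left F_neg F_diff

lemma P_add: "P (x + y) z = P x z + P y z" "P x (y + z) = P x y + P x z"
  and P_self: "P x x = 0"
  and P_jacobi: "P x (P y z) + (P y (P z x) + P z (P x y)) = 0"
  and P_mult_left: "P (x * y) z = x * P y z + y * P x z"
  using poisson
  by (auto simp: restricted_poisson_algebra_def restricted_lie_algebra_on_def lie_algebra_on_def)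

lemma S_add: "S (x + y) = S x + S y + P x y"
  and S_ad: "P (S x) y = P x (P x y)"
  and S_scale: "S (\<iota> c * x) = \<iota> (c * c) * S x"
  and S_mult: "S (x * y) = x\<^sup>2 * S y + y\<^sup>2 * S x + x * y * P x y"
  using poisson
  by (auto simp: restricted_poisson_algebra_def restricted_lie_algebra_on_def)

text \<open>Polarizing \<open>P_self\<close> at \<open>x + y\<close> gives
  \<open>P x y + P y x = 0\<close>, and signs disappear in characteristic 2.\<close>

lemma P_sym: "P x y = P y x"
  using P_self[of "x + y"] by (metis P_add P_self add_0 add.right_neutral add_self_left)

lemma P_mult: "P (x * y) z = x * P y z + y * P x z" "P z (x * y) = x * P z y + y * P z x"
  using P_mult_left P_sym by metis+

lemma P_iota_mult: "P (\<iota> c * x) y = \<iota> c * P x y"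
  using poisson
  by (auto simp: restricted_poisson_algebra_def restricted_lie_algebra_on_def lie_algebra_on_def)

lemma P_1: "P 1 x = 0"
  using P_mult_left[of 1 1 x] by simp

lemma P_iota: "P (\<iota> c) x = 0" "P x (\<iota> c) = 0"
  using P_iota_mult[of c 1 x] P_1 P_sym[of x] by simp_all

lemma P_0: "P 0 x = 0" "P x 0 = 0"
  using P_iota(1)[of 0 x] P_iota(2)[of x 0] by (simp_all add: iota_0)

text \<open>The product rule at \<open>1 * 1\<close> gives
  \<open>S 1 = S 1 + S 1 + P 1 1 = 0\<close>; \<open>S_scale\<close> carries this to all
  scalars.\<close>

lemma S_iota: "S (\<iota> c) = 0"
proof -
  have "S 1 = 0" using S_mult[of 1 1] by (simp add: P_self add_self)
  then show ?thesis using S_scale[of c 1] by simp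
qed

lemma P_jacobi': "P x (P y z) = P y (P x z) + P z (P x y)"
  using P_jacobi[of x y z] add_self_left[of "P x (P y z)" "P y (P z x) + P z (P x y)"]
  by (simp add: P_sym[of z x])

lemma P_ad_bracket: "P (P x y) z = P x (P y z) + P y (P x z)"
  using P_jacobi'[of x y z] P_sym[of "P x y" z] by (simp add: ac_simps char2)

section \<open>Calculating modulo the Kaehler relations\<close>

lemma p_0: "p 0 = 0"
  using p_add[of 0 0] by simp

lemma p_eq_iff: "p f = p g \<longleftrightarrow> f - g \<in> kahler_rel \<iota>"
proof -
  have "p f = p (f - g) + p g" by (simp flip: p_add)
  then show ?thesis by (simp flip: p_eq_0_iff)
qed

lemma p_rel: "f - g \<in> kahler_rel \<iota> \<Longrightarrow> p f = p g"
  by (simp add: p_eq_iff)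

text \<open>Scalars from \<open>A\<close> cannot be pulled out of \<open>p\<close>, but congruence
  modulo the relations survives scaling because the relations form an
  \<open>A\<close>-submodule.\<close>

lemma p_fsm_cong: "p f = p g \<Longrightarrow> p (fsm a f) = p (fsm a g)"
  unfolding p_eq_iff fsm_diff[symmetric] unfolding fsm_def by (rule kahler_rel.rel_smul)

lemma p_fsm_cong_rel: "p f = 0 \<Longrightarrow> p (fsm a f) = 0"
  using p_fsm_cong[of f 0 a] by (simp add: p_0)

lemma p_gen_mult: "p (gen z (x * y)) = p (gen (z * x) y) + p (gen (z * y) x)"
proof -
  have "p (gen 1 (x * y)) = p (gen x y + gen y x)"
    using kahler_rel.rel_mult[of x y \<iota>] by (intro p_rel) (simp add: fun_diff_def plus_fun_def diff_diff_eq)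
  from p_fsm_cong[OF this, of z] show ?thesis by (simp add: fsm_gen fsm_add p_add)
qed

lemma p_gen_add: "p (gen z (x + y)) = p (gen z x) + p (gen z y)"
proof -
  have "p (gen 1 (x + y)) = p (gen 1 x + gen 1 y)"
    using kahler_rel.rel_add[of x y \<iota>] by (intro p_rel) (simp add: fun_diff_def plus_fun_def diff_diff_eq)
  from p_fsm_cong[OF this, of z] show ?thesis by (simp add: fsm_gen fsm_add p_add)
qed

lemma p_gen_iota: "p (gen z (\<iota> c)) = 0"
proof -
  have "p (gen 1 (\<iota> c)) = 0" unfolding p_eq_0_iff by (rule kahler_rel.rel_scalar)
  from p_fsm_cong_rel[OF this, of z] show ?thesis by (simp add: fsm_gen)
qed

lemma p_gen_0: "p (gen z 0) = 0"
  using p_gen_iota[of z 0] by (simp add: iota_0)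

lemmas p_simps = p_add p_gen_mult p_gen_add p_gen_iota p_gen_0 p_0 gen_add

section \<open>Bracket and anchor on the free module\<close>

lemma br_gen_add:
  "br_gen P (x + x') u y v = br_gen P x u y v + br_gen P x' u y v"
  "br_gen P x u (y + y') v = br_gen P x u y v + br_gen P x u y' v"
  by (simp_all add: br_gen_def fun_eq_iff fun_apply P_add algebra_simps gen_def)

lemma br_gen_eq:
  "br_gen P x u y v = gen (x * P u y) v + gen (y * P x v) u + gen (x * y) (P u v)"
  by (simp add: br_gen_def fun_eq_iff fun_apply)

lemma br_gen_0: "br_gen P 0 u y v = 0" "br_gen P x u 0 v = 0"
  by (simp_all add: br_gen_eq P_0)

lemma br_gen_sym: "br_gen P x u y v = br_gen P y v x u"
  by (simp add: br_gen_eq P_sym ac_simps)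

lemma fsupp_br_gen [simp]: "fsupp (br_gen P x u y v)"
  by (simp add: br_gen_eq)

lemma fsupp_fbr [simp]: "fsupp (fbr P f g)"
  unfolding fbr_def by (intro fsupp_lin fsupp_br_gen)

lemma additive_fbr_left: "additive_coeff (\<lambda>x u. lin (\<lambda>y v. br_gen P x u y v) g)"
  by (simp add: additive_coeff_def lin_def br_gen_add sum.distrib)

lemma fbr_add_left: "fsupp f \<Longrightarrow> fsupp f' \<Longrightarrow> fbr P (f + f') g = fbr P f g + fbr P f' g"
  unfolding fbr_def by (rule lin_add[OF additive_fbr_left])

lemma fbr_sym: "fbr P f g = fbr P g f"
  unfolding fbr_def lin_def 
  by (subst sum.swap) (intro sum.cong refl br_gen_sym)

lemma fbr_add_right: "fsupp g \<Longrightarrow> fsupp g' \<Longrightarrow> fbr P f (g + g') = fbr P f g + fbr P f g'"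
  using fbr_add_left fbr_sym by metis

lemma fbr_gen: "fbr P (gen x u) (gen y v) = br_gen P x u y v"
  by (simp add: fbr_def lin_gen br_gen_0)

lemma fanc_add: "fsupp f \<Longrightarrow> fsupp g \<Longrightarrow> fanc P (f + g) a = fanc P f a + fanc P g a"
  unfolding fanc_def by (rule lin_add) (auto simp: additive_coeff_def algebra_simps)

lemma fanc_gen: "fanc P (gen x u) a = x * P u a"
  by (simp add: fanc_def lin_gen)

lemma fanc_fsm: "fsupp f \<Longrightarrow> fanc P (fsm b f) a = b * fanc P f a"
  by (induction rule: fsupp_induct) (simp_all add: fanc_gen fsm_gen fsm_add fanc_add algebra_simps)

lemma is_derivation_fanc: "is_derivation \<iota> (fanc P f)"
  unfolding is_derivation_def fanc_def lin_def
  by (auto simp: P_add P_mult P_iota sum_distrib_left sum.distrib[symmetric] algebra_simps intro!: sum.cong)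

lemma fanc_add_right: "fanc P f (a + b) = fanc P f a + fanc P f b"
  using is_derivation_fanc[of f] by (simp add: is_derivation_def)

lemma fanc_iota: "fanc P f (\<iota> c) = 0"
  by (simp add: fanc_def P_iota)

text \<open>This holds in the free module itself, not only modulo relations: on generators the
  anchor term is the summand \<open>x * y * P u a\<close> of \<open>x * P u (a * y)\<close>.\<close>

lemma fbr_fsm_right:
  assumes "fsupp f" "fsupp g"
  shows "fbr P f (fsm a g) = fsm a (fbr P f g) + fsm (fanc P f a) g"
  using assms(1)
proof (induction rule: fsupp_induct)
  case (gen x u)
  show ?case using assms(2)
  proof (induction rule: fsupp_induct)
    case (gen y v)
    show ?case
      by (simp add: fbr_gen fsm_gen fanc_gen br_gen_eq fsm_add P_mult gen_add algebra_simps)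
  qed (simp add: fbr_add_right fsm_add algebra_simps)
qed (simp add: fbr_add_left fanc_add fsm_add fsm_add_left algebra_simps)

lemma lin_p_hom: "p (lin \<phi> f) = lin (\<lambda>x u. p (\<phi> x u)) f"
proof -
  have "p (\<Sum>u\<in>U. \<phi> (f u) u) = (\<Sum>u\<in>U. p (\<phi> (f u) u))" for U
    by (induction U rule: infinite_finite_induct) (simp_all add: p_0 p_add)
  then show ?thesis by (simp add: lin_def)
qed

lemma kahler_map_br_gen: "kahler_map \<iota> (\<lambda>x u. p (br_gen P x u y v))"
  unfolding kahler_map_def additive_coeff_def
  by (simp add: br_gen_eq p_simps P_add P_mult P_iota algebra_simps)

text \<open>Summing \<open>kahler_map_br_gen\<close> over the terms of \<open>g\<close> gives a map
  in the first argument that respects the Kaehler relations.\<close>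

lemma fbr_kahler_rel:
  assumes "f \<in> kahler_rel \<iota>" shows "p (fbr P f g) = 0"
proof -
  have "kahler_map \<iota> (\<lambda>x u. p (lin (\<lambda>y v. br_gen P x u y v) g))"
    using kahler_map_br_gen unfolding lin_p_hom kahler_map_def additive_coeff_def
    by (simp add: lin_coeff_add)
  from lin_kahler_rel[OF this assms] show ?thesis by (simp add: fbr_def lin_p_hom)
qed

text \<open>The map \<open>u \<mapsto> P u a\<close> is a derivation that kills scalars.\<close>

lemma fanc_kahler_rel:
  assumes "f \<in> kahler_rel \<iota>" shows "fanc P f a = 0"
  unfolding fanc_def using assms
  by (rule lin_kahler_rel[rotated])
    (auto simp: kahler_map_def additive_coeff_def P_mult P_add P_iota algebra_simps)

text \<open>The cross terms of a sum cancel by symmetry. On a generator the term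
  \<open>d(P u u) = d 0\<close> remains, which is zero only modulo the relations.\<close>

lemma fbr_self: "fsupp f \<Longrightarrow> p (fbr P f f) = 0"
proof (induction rule: fsupp_induct)
  case (gen x u)
  show ?case by (simp add: fbr_gen br_gen_eq p_simps P_self P_sym char2)
next
  case (add f g)
  then show ?case using fbr_sym[of f g] by (simp add: fbr_add_left fbr_add_right p_add char2)
qed

lemma fanc_fbr:
  assumes "fsupp f" "fsupp g"
  shows "fanc P (fbr P f g) a = fanc P f (fanc P g a) + fanc P g (fanc P f a)"
  using assms(1)
proof (induction rule: fsupp_induct)
  case (gen x u)
  show ?case using assms(2)
  proof (induction rule: fsupp_induct)
    case (gen y v)
    show ?case
      by (simp add: fbr_gen fanc_gen br_gen_eq fanc_add P_mult P_ad_bracket P_sym[of v x] algebra_simps)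
  next
    case (add f g)
    then show ?case  by (simp add: fbr_add_right fanc_add fanc_add_right algebra_simps)
  qed
next
  case (add f h)
  then show ?case  by (simp add: fbr_add_left fanc_add fanc_add_right algebra_simps)
qed

lemma fbr_jacobi_gen:
  "p (fbr P (gen x u) (fbr P (gen y v) (gen z w)))
   = p (fbr P (gen y v) (fbr P (gen x u) (gen z w))) + p (fbr P (fbr P (gen x u) (gen y v)) (gen z w))"
proof -
  have out: "P c (P a b) = P a (P b c) + P b (P a c)" for a b c
    by (metis P_ad_bracket P_sym)
  \<comment> \<open>Every bracket of two letters is put into alphabetical order.\<close>
  note sym = P_sym[of v u] P_sym[of w u] P_sym[of x u] P_sym[of y u] P_sym[of z u]
    P_sym[of w v] P_sym[of x v] P_sym[of y v] P_sym[of z v]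
    P_sym[of x w] P_sym[of y w] P_sym[of z w] P_sym[of y x] P_sym[of z x] P_sym[of z y]
  \<comment> \<open>Each Jacobi instance takes one letter from each of the pairs
    \<open>x, u\<close>, \<open>y, v\<close> and \<open>z, w\<close>, which makes eight; the
    alphabetically last letter is moved out of the outer position.\<close>
  note jac = out[of w u v] out[of x v w] out[of y u w] out[of z u v]
    out[of y w x] out[of z v x] out[of z u y] out[of z x y]
  show ?thesis
    by (simp add: fbr_gen br_gen_eq fbr_add_left fbr_add_right p_simps P_mult P_add P_ad_bracket
      sym jac char2 algebra_simps)
qed

lemma fbr_jacobi:
  assumes "fsupp f" "fsupp g" "fsupp h"
  shows "p (fbr P f (fbr P g h)) = p (fbr P g (fbr P f h)) + p (fbr P (fbr P f g) h)"
  using assms(1)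
proof (induction rule: fsupp_induct)
  case (gen x u)
  show ?case using assms(2)
  proof (induction rule: fsupp_induct)
    case (gen y v)
    show ?case using assms(3)
    proof (induction rule: fsupp_induct)
      case (gen z w)
      show ?case by (rule fbr_jacobi_gen)
    qed (simp add: fbr_add_right p_add algebra_simps)
  qed (simp add: assms fbr_add_left fbr_add_right p_add algebra_simps)
qed (simp add: assms fbr_add_left fbr_add_right p_add algebra_simps)

section \<open>The square on the free module\<close>

lemma fsupp_fsq [simp]: "fsupp (fsq P S r f)"
  unfolding fsq_def by (intro fsupp_add fsupp_lin) simp_all

lemma square_add: "((x::'a) + y)\<^sup>2 = x\<^sup>2 + y\<^sup>2"
  by (simp add: power2_eq_square algebra_simps char2)

lemma fsq_gen: "fsq P S r (gen x u) = gen (x\<^sup>2) (S u) + gen (x * P u x) u"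
  by (simp add: fsq_def lin_gen br_gen_0 r_irrefl)

text \<open>In the double sum, the part with \<open>u\<close> before \<open>v\<close> plus its transpose is the off-diagonal part
  of the bracket; the diagonal part comes from the terms \<open>x P(u, x) du\<close>.\<close>

lemma fsq_add:
  assumes "fsupp f" "fsupp g"
  shows "p (fsq P S r (f + g)) = p (fsq P S r f) + p (fsq P S r g) + p (fbr P f g)"
proof -
  define U where "U = {u. f u \<noteq> 0} \<union> {u. g u \<noteq> 0}"
  have U: "finite U" using assms by (simp add: U_def fsupp_def)
  define h where "h a b u v = (if (u, v) \<in> r then br_gen P (a u) u (b v) v else 0)" for a b :: "'a \<Rightarrow> 'a" and u v
  define q where "q a u = gen ((a u)\<^sup>2) (S u) + gen (a u * P u (a u)) u" for a :: "'a \<Rightarrow> 'a" and u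
  have lin2: "lin (\<lambda>x u. lin (\<lambda>y v. \<phi> x u y v) b) a = (\<Sum>u\<in>U. \<Sum>v\<in>U. \<phi> (a u) u (b v) v)"
    if "\<And>u. a u \<noteq> 0 \<Longrightarrow> u \<in> U" "\<And>u. b u \<noteq> 0 \<Longrightarrow> u \<in> U" 
      "\<And>u y v. \<phi> 0 u y v = 0" "\<And>x u v. \<phi> x u 0 v = 0"
    for a b :: "'a \<Rightarrow> 'a" and \<phi> :: "'a \<Rightarrow> 'a \<Rightarrow> 'a \<Rightarrow> 'a \<Rightarrow> 'a \<Rightarrow> 'a"
    using that by (subst lin_eq_sum[OF U]) (auto simp: lin_eq_sum[OF U])
  have sq: "fsq P S r a = (\<Sum>u\<in>U. q a u) + (\<Sum>u\<in>U. \<Sum>v\<in>U. h a a u v)"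
    if "\<And>u. a u \<noteq> 0 \<Longrightarrow> u \<in> U" for a
  proof -
    have "lin (\<lambda>x u. gen (x\<^sup>2) (S u) + gen (x * P u x) u) a = (\<Sum>u\<in>U. q a u)"
      unfolding q_def using that by (intro lin_eq_sum[OF U]) auto
    moreover have "lin (\<lambda>x u. lin (\<lambda>y v. if (u, v) \<in> r then br_gen P x u y v else 0) a) a
        = (\<Sum>u\<in>U. \<Sum>v\<in>U. h a a u v)"
      unfolding h_def using that by (intro lin2) (auto simp: br_gen_0)
    ultimately show ?thesis by (simp add: fsq_def)
  qed
  have fg: "u \<in> U" if "(f + g) u \<noteq> 0" for u
    using that by (auto simp: U_def fun_apply)
  have sf: "u \<in> U" if "f u \<noteq> 0" for u using that by (simp add: U_def)
  have sg: "u \<in> U" if "g u \<noteq> 0" for u using that by (simp add: U_def)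
  \<comment> \<open>The polarization of \<open>x P(u, x) du\<close> in \<open>x\<close>; the part
    \<open>x\<^sup>2 d(S u)\<close> is additive in characteristic 2.\<close>
  define e where "e u = gen (f u * P u (g u) + g u * P u (f u)) u" for u
  have q: "q (f + g) u = q f u + q g u + e u" for u
    by (simp add: q_def e_def fun_apply square_add P_add gen_add algebra_simps)
  have hadd: "h (f + g) (f + g) u v = h f f u v + h g g u v + (h f g u v + h g f u v)" for u v
    by (simp add: h_def fun_apply br_gen_add algebra_simps)
  have br: "fbr P f g = (\<Sum>u\<in>U. \<Sum>v\<in>U. br_gen P (f u) u (g v) v)"
    unfolding fbr_def by (intro lin2 sf sg) (simp_all add: br_gen_0)
  have split: "br_gen P (f u) u (g v) v
      = h f g u v + h g f v u + (if u = v then br_gen P (f u) u (g u) u else 0)" for u v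
    using r_irrefl[of u] r_total[of u v] by (auto simp: h_def br_gen_sym[of "g v"])
  have br': "fbr P f g = (\<Sum>u\<in>U. \<Sum>v\<in>U. h f g u v) + (\<Sum>u\<in>U. \<Sum>v\<in>U. h g f u v)
      + (\<Sum>u\<in>U. br_gen P (f u) u (g u) u)"
  proof -
    have "fbr P f g = (\<Sum>u\<in>U. \<Sum>v\<in>U. h f g u v + h g f v u
        + (if u = v then br_gen P (f u) u (g u) u else 0))"
      unfolding br by (intro sum.cong refl split)
    also have "\<dots> = (\<Sum>u\<in>U. \<Sum>v\<in>U. h f g u v) + (\<Sum>u\<in>U. \<Sum>v\<in>U. h g f v u)
        + (\<Sum>u\<in>U. br_gen P (f u) u (g u) u)"
      using U by (simp add: sum.distrib)
    also have "(\<Sum>u\<in>U. \<Sum>v\<in>U. h g f v u) = (\<Sum>u\<in>U. \<Sum>v\<in>U. h g f u v)"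
      by (rule sum.swap)
    finally show ?thesis .
  qed
  \<comment> \<open>The diagonal bracket differs from \<open>e u\<close> by a multiple of
    \<open>d(P u u) = d 0\<close>, so the two agree only after applying \<open>p\<close>.\<close>
  have e: "p (br_gen P (f u) u (g u) u) = p (e u)" for u
    by (simp add: br_gen_eq e_def P_self P_sym[of "f u" u] p_simps)
  have p_sum: "p (\<Sum>i\<in>I. F i) = (\<Sum>i\<in>I. p (F i))" for I :: "'a set" and F
    by (induction I rule: infinite_finite_induct) (simp_all add: p_0 p_add)
  have "fsq P S r (f + g) = fsq P S r f + fsq P S r g
      + ((\<Sum>u\<in>U. \<Sum>v\<in>U. h f g u v) + (\<Sum>u\<in>U. \<Sum>v\<in>U. h g f u v) + (\<Sum>u\<in>U. e u))"
    using sq[of "f + g", OF fg] sq[of f, OF sf] sq[of g, OF sg]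
    by (simp add: q hadd sum.distrib algebra_simps)
  then show ?thesis
    by (simp add: br' p_add p_sum e)
qed

text \<open>Generators follow from the Leibniz rule for \<open>P\<close>. For sums, the anchor terms
  in the expansion of \<open>[a f, a g]\<close> are exactly the mixed terms of
  \<open>\<theta>(a(f + g))(a) (f + g)\<close>.\<close>

lemma fsq_fsm:
  "fsupp f \<Longrightarrow> p (fsq P S r (fsm a f)) = p (fsm (a * a) (fsq P S r f) + fsm (fanc P (fsm a f) a) f)"
proof (induction rule: fsupp_induct)
  case (gen x u)
  show ?case
    by (simp add: fsq_gen fsm_gen fanc_gen fsm_add P_mult gen_add p_add power2_eq_square algebra_simps)
next
  case (add f g)
  \<comment> \<open>\<open>fsq_add\<close> is an identity under \<open>p\<close> only, so
    multiplying it by \<open>a * a\<close> goes through \<open>p_fsm_cong\<close>.\<close>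
  have sq: "p (fsm (a * a) (fsq P S r (f + g)))
      = p (fsm (a * a) (fsq P S r f + fsq P S r g + fbr P f g))"
    using fsq_add[OF add.hyps] by (intro p_fsm_cong) (simp add: p_add)
  have "fbr P (fsm a f) (fsm a g) = fsm (a * a) (fbr P f g) + fsm (a * fanc P g a) f + fsm (a * fanc P f a) g"
    using add.hyps
    by (simp add: fbr_fsm_right fbr_sym[of "fsm a f" g] fbr_sym[of g f] fanc_fsm fsm_fsm fsm_add algebra_simps)
  then show ?case
    using add by (simp add: sq p_add fsm_add fsm_add_left fsq_add fanc_add fanc_fsm algebra_simps)
qed

lemma fsq_kahler_rel:
  assumes "f \<in> kahler_rel \<iota>" shows "p (fsq P S r f) = 0"
  using assms
proof (induction rule: kahler_rel.induct)
  case (rel_mult x y)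
  \<comment> \<open>Written as a sum, the relation can be expanded by
    \<open>fsq_add\<close>.\<close>
  have *: "(\<lambda>v. gen 1 (x * y) v - gen x y v - gen y x v) = gen 1 (x * y) + (gen x y + gen y x)"
    by (simp add: fun_eq_iff fun_apply diff_eq add.assoc)
  show ?case unfolding *
    by (simp add: fsq_add fsq_gen fbr_add_right fbr_gen br_gen_eq p_simps S_mult P_mult P_self P_0 P_1 P_sym[of y x]
      power2_eq_square char2 algebra_simps)
next
  case (rel_add x y)
  have *: "(\<lambda>v. gen 1 (x + y) v - gen 1 x v - gen 1 y v) = gen 1 (x + y) + (gen 1 x + gen 1 y)"
    by (simp add: fun_eq_iff fun_apply diff_eq add.assoc)
  have "P z 1 = 0" for z using P_1 P_sym by metis
  then show ?case unfolding *
    by (simp add: fsq_add fsq_gen fbr_add_right fbr_gen br_gen_eq p_simps S_add P_add P_self P_1 P_sym[of y x]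
      char2 algebra_simps)
next
  case (rel_scalar c)
  show ?case by (simp add: fsq_gen S_iota P_iota p_simps)
next
  case rel_zero
  have "fsq P S r 0 = 0" by (simp add: fsq_def)
  then show ?case by (simp add: zero_fun_def[symmetric] p_0)
next
  case (rel_plus f g)
  then have "p (fsq P S r (f + g)) = 0"
    by (simp add: fsq_add kahler_rel_fsupp fbr_kahler_rel)
  then show ?case by (simp add: plus_fun_def)
next
  case (rel_smul f a)
  \<comment> \<open>The anchor term in \<open>fsq_fsm\<close> is a multiple of \<open>f\<close> and
    so vanishes modulo relations; the other term vanishes by induction.\<close>
  have "p f = 0" using rel_smul by (simp add: p_eq_0_iff)
  then have "p (fsq P S r (fsm a f)) = 0"
    using rel_smul by (simp add: fsq_fsm kahler_rel_fsupp p_add p_fsm_cong_rel)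
  then show ?case by (simp add: fsm_def)
qed

text \<open>Both sides have the polarization \<open>\<theta>([f, g])\<close>, by
  \<open>fanc_fbr\<close>.\<close>

lemma fanc_fsq: "fsupp f \<Longrightarrow> fanc P (fsq P S r f) a = fanc P f (fanc P f a)"
proof (induction rule: fsupp_induct)
  case (gen x u)
  show ?case by (simp add: fsq_gen fanc_add fanc_gen S_ad P_mult power2_eq_square algebra_simps)
next
  case (add f g)
  \<comment> \<open>The defect of additivity of the square is a Kaehler relation, and the anchor
    vanishes there.\<close>
  let ?d = "fsq P S r (f + g) - (fsq P S r f + fsq P S r g + fbr P f g)"
  have "?d \<in> kahler_rel \<iota>"
    using fsq_add[OF add.hyps] by (simp only: p_eq_iff[symmetric] p_add)
  then have "fanc P ?d a = 0" by (rule fanc_kahler_rel)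
  moreover have "fsq P S r (f + g) = ?d + (fsq P S r f + fsq P S r g + fbr P f g)" by simp
  ultimately have "fanc P (fsq P S r (f + g)) a = fanc P (fsq P S r f + fsq P S r g + fbr P f g) a"
    using fanc_add[of ?d "fsq P S r f + fsq P S r g + fbr P f g" a] by simp
  then show ?case using add
    by (simp add: fanc_add fanc_fbr fanc_add_right algebra_simps)
qed

section \<open>Independence of representatives and the remaining square identity\<close>

lemma fbr_cong:
  assumes "fsupp f" "fsupp f'" "fsupp g" "fsupp g'" "p f = p f'" "p g = p g'"
  shows "p (fbr P f g) = p (fbr P f' g')"
proof -
  have *: "p (fbr P f g) = p (fbr P f' g)" if "fsupp f" "fsupp f'" "p f = p f'" for f f' g
    using fbr_kahler_rel[of "f - f'" g] that fbr_add_left[of "f - f'" f' g]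
    by (simp add: p_eq_iff[of f] p_add)
  show ?thesis using *[of f f' g] *[of g g' f'] assms by (simp add: fbr_sym[of f'])
qed

lemma fanc_cong: "fsupp f \<Longrightarrow> fsupp g \<Longrightarrow> p f = p g \<Longrightarrow> fanc P f = fanc P g"
  using fanc_kahler_rel[of "f - g"] fanc_add[of "f - g" g]
  by (intro ext) (simp add: p_eq_iff)

text \<open>In the expansion of the square at \<open>f = (f - g) + g\<close>, both the square of
  \<open>f - g\<close> and its bracket with \<open>g\<close> are relations.\<close>

lemma fsq_cong: 
  assumes "fsupp f" "fsupp g" "p f = p g"
  shows "p (fsq P S r f) = p (fsq P S r g)"
proof -
  have "f - g \<in> kahler_rel \<iota>" using assms by (simp add: p_eq_iff)
  then show ?thesis
    using fsq_kahler_rel[of "f - g"] fbr_kahler_rel[of "f - g" g] fsq_add[of "f - g" g] assms by simp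
qed

text \<open>Passing to \<open>f + h\<close> adds \<open>[[f, h], g]\<close> on the left and
  \<open>[f, [h, g]] + [h, [f, g]]\<close> on the right; these agree by the Jacobi identity.\<close>

lemma fbr_fsq:
  assumes "fsupp f" "fsupp g"
  shows "p (fbr P (fsq P S r f) g) = p (fbr P f (fbr P f g))"
  using assms(1)
proof (induction rule: fsupp_induct)
  case (gen x u)
  show ?case using assms(2)
  proof (induction rule: fsupp_induct)
    case (gen y v)
    show ?case
      by (simp add: fsq_gen fbr_add_left fbr_add_right fbr_gen br_gen_eq p_simps S_ad P_mult P_ad_bracket
        P_self P_0 P_sym[of x u] P_sym[of v x] P_sym[of v u] power2_eq_square char2 algebra_simps)
  qed (simp add: fbr_add_right p_add algebra_simps)
next
  case (add f h)
  have "p (fbr P (fsq P S r (f + h)) g) = p (fbr P (fsq P S r f + fsq P S r h + fbr P f h) g)"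
    using add.hyps assms(2) by (intro fbr_cong) (simp_all add: fsq_add p_add)
  then show ?case using add assms(2) fbr_jacobi[of f h g]
    by (simp add: fbr_add_left fbr_add_right p_add char2 algebra_simps)
qed

section \<open>Transfer to classes of differentials\<close>

text \<open>Classes are the fibres of \<open>p\<close> among finitely supported functions, so
  equations between classes become equations under \<open>p\<close>.\<close>

lemma kcls_eq: "kcls \<iota> f = {g. fsupp g \<and> p f = p g}"
  by (simp add: kcls_def p_eq_iff fun_diff_def)

lemma kcls_eq_iff: "fsupp f \<Longrightarrow> fsupp g \<Longrightarrow> kcls \<iota> f = kcls \<iota> g \<longleftrightarrow> p f = p g"
  by (auto simp: kcls_eq)

lemma kcls_cong: "p f = p g \<Longrightarrow> kcls \<iota> f = kcls \<iota> g"
  by (simp add: kcls_eq)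

lemma krep_kcls:
  assumes "fsupp f"
  shows "fsupp (krep (kcls \<iota> f))" "p (krep (kcls \<iota> f)) = p f"
proof -
  have "f \<in> kcls \<iota> f" using assms by (simp add: kcls_eq)
  then have "krep (kcls \<iota> f) \<in> kcls \<iota> f" 
    unfolding krep_def by (rule someI[of "\<lambda>g. g \<in> kcls \<iota> f"])
  then show "fsupp (krep (kcls \<iota> f))" "p (krep (kcls \<iota> f)) = p f"
    by (simp_all add: kcls_eq)
qed

lemma oadd_kcls: "fsupp f \<Longrightarrow> fsupp g \<Longrightarrow> oadd \<iota> (kcls \<iota> f) (kcls \<iota> g) = kcls \<iota> (f + g)"
  using kcls_cong[of "krep (kcls \<iota> f) + krep (kcls \<iota> g)" "f + g"]
  by (simp add: oadd_def p_add krep_kcls) (simp add: plus_fun_def)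

lemma osmul_kcls: "fsupp f \<Longrightarrow> osmul \<iota> a (kcls \<iota> f) = kcls \<iota> (fsm a f)"
  using kcls_cong[OF p_fsm_cong[OF krep_kcls(2)], of f a] by (simp add: osmul_def fsm_def)

lemma oneg_kcls: "fsupp f \<Longrightarrow> oneg \<iota> (kcls \<iota> f) = kcls \<iota> f"
  unfolding oneg_def neg_eq by (intro kcls_cong krep_kcls)

lemma obr_kcls:
  assumes "fsupp f" "fsupp g"
  shows "obr \<iota> P (kcls \<iota> f) (kcls \<iota> g) = kcls \<iota> (fbr P f g)"
proof -
  have "obr \<iota> P X Y = kcls \<iota> (fbr P (krep X) (krep Y))" for X Y
    unfolding obr_def fbr_def lin_def
    by (rule arg_cong[of _ _ "kcls \<iota>"]) (simp add: fun_eq_iff sum_fun_apply)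
  then show ?thesis
    by (simp only:) (intro kcls_cong fbr_cong krep_kcls assms)
qed

lemma anchor_kcls:
  assumes "fsupp f" shows "anchor P (kcls \<iota> f) = fanc P f"
proof -
  have "anchor P (kcls \<iota> f) = fanc P (krep (kcls \<iota> f))"
    by (rule ext) (simp add: anchor_def fanc_def lin_def)
  also have "\<dots> = fanc P f"
    using assms by (intro fanc_cong krep_kcls)
  finally show ?thesis .
qed

text \<open>The representative is an arbitrary choice; \<open>osq_kcls\<close> shows that the class
  does not depend on it.\<close>

definition osq :: "('a \<Rightarrow> 'a) set \<Rightarrow> ('a \<Rightarrow> 'a) set" where
  "osq X = kcls \<iota> (fsq P S r (krep X))"

lemma osq_kcls: "fsupp f \<Longrightarrow> osq (kcls \<iota> f) = kcls \<iota> (fsq P S r f)"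
  unfolding osq_def by (intro kcls_cong fsq_cong krep_kcls)

lemma ball_Omega1: "(\<forall>X\<in>Omega1 \<iota>. Q X) \<longleftrightarrow> (\<forall>f. fsupp f \<longrightarrow> Q (kcls \<iota> f))"
  by (auto simp: Omega1_def)

lemma kcls_in_Omega1: "fsupp f \<Longrightarrow> kcls \<iota> f \<in> Omega1 \<iota>"
  by (auto simp: Omega1_def)

lemma ozero_eq: "ozero \<iota> = kcls \<iota> 0"
  by (simp add: ozero_def zero_fun_def)

lemmas lift_kcls = ball_Omega1 kcls_in_Omega1 ozero_eq oadd_kcls osmul_kcls oneg_kcls obr_kcls
  anchor_kcls osq_kcls kcls_eq_iff

section \<open>The restricted Lie and Lie-Rinehart axioms\<close>

lemma module_on_Omega1: "module_on (Omega1 \<iota>) (oadd \<iota>) (ozero \<iota>) (oneg \<iota>) (osmul \<iota>)"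
  unfolding module_on_def
  by (simp add: lift_kcls fsm_fsm fsm_add fsm_add_left p_add p_0 char2 ac_simps)

lemma module_on_Omega1_scalars:
  "module_on (Omega1 \<iota>) (oadd \<iota>) (ozero \<iota>) (oneg \<iota>) (\<lambda>c X. osmul \<iota> (\<iota> c) X)"
  unfolding module_on_def
  by (simp add: lift_kcls fsm_fsm fsm_add fsm_add_left p_add p_0 iota char2 ac_simps)

lemma fbr_fsm_iota:
  assumes "fsupp f" "fsupp g"
  shows "fbr P f (fsm (\<iota> c) g) = fsm (\<iota> c) (fbr P f g)" "fbr P (fsm (\<iota> c) f) g = fsm (\<iota> c) (fbr P f g)"
proof -
  have *: "fbr P f (fsm (\<iota> c) g) = fsm (\<iota> c) (fbr P f g)" if "fsupp f" "fsupp g" for f g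
    using that by (simp add: fbr_fsm_right fanc_iota) (simp add: fsm_def fun_eq_iff fun_apply)
  show "fbr P f (fsm (\<iota> c) g) = fsm (\<iota> c) (fbr P f g)" "fbr P (fsm (\<iota> c) f) g = fsm (\<iota> c) (fbr P f g)"
    using *[OF assms] *[OF assms(2,1)] by (simp_all add: fbr_sym[of "fsm (\<iota> c) f" g] fbr_sym[of f g])
qed

lemma fsq_fsm_iota:
  assumes "fsupp f"
  shows "p (fsq P S r (fsm (\<iota> c) f)) = p (fsm (\<iota> (c * c)) (fsq P S r f))"
proof -
  have "fsm 0 f = 0" by (simp add: fsm_def fun_eq_iff fun_apply)
  then show ?thesis using fsq_fsm[OF assms, of "\<iota> c"] by (simp add: fanc_iota iota)
qed

lemma fbr_jacobi_cyclic:
  assumes "fsupp f" "fsupp g" "fsupp h"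
  shows "p (fbr P f (fbr P g h)) + (p (fbr P g (fbr P h f)) + p (fbr P h (fbr P f g))) = 0"
proof -
  have "p (fbr P f (fbr P g h)) = p (fbr P g (fbr P h f)) + p (fbr P h (fbr P f g))"
    using fbr_jacobi[OF assms] unfolding fbr_sym[of f h] fbr_sym[of "fbr P f g" h] .
  then show ?thesis by (simp only: F_add_self)
qed

lemma lie_algebra_on_Omega1:
  "lie_algebra_on (Omega1 \<iota>) (oadd \<iota>) (ozero \<iota>) (oneg \<iota>) (\<lambda>c X. osmul \<iota> (\<iota> c) X) (obr \<iota> P)"
  unfolding lie_algebra_on_def
  by (simp add: module_on_Omega1_scalars)
    (simp add: lift_kcls fbr_add_left fbr_add_right fbr_fsm_iota fbr_self fbr_jacobi_cyclic p_add p_0)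

lemma restricted_lie_algebra_on_Omega1:
  "restricted_lie_algebra_on (Omega1 \<iota>) (oadd \<iota>) (ozero \<iota>) (oneg \<iota>)
     (\<lambda>c X. osmul \<iota> (\<iota> c) X) (obr \<iota> P) osq"
  unfolding restricted_lie_algebra_on_def
  by (simp add: lie_algebra_on_Omega1)
    (simp add: lift_kcls fsq_fsm_iota fbr_fsq fsq_add p_add)

lemma restricted_lie_rinehart_Omega1:
  "restricted_lie_rinehart \<iota> (Omega1 \<iota>) (oadd \<iota>) (ozero \<iota>) (oneg \<iota>) (osmul \<iota>) (obr \<iota> P) osq (anchor P)"
  unfolding restricted_lie_rinehart_def
  by (simp add: module_on_Omega1 restricted_lie_algebra_on_Omega1)
    (simp add: lift_kcls is_derivation_fanc fun_eq_iff[of "fanc P _"] fanc_add fanc_fsm fanc_fbr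
      fanc_fsq fbr_fsm_right fsq_fsm diff_eq)

lemma osq_odiff:
  "osq (odiff \<iota> x u) = oadd \<iota> (odiff \<iota> (x\<^sup>2) (S u)) (odiff \<iota> (x * P u x) u)"
  by (simp add: odiff_def osq_kcls oadd_kcls fsq_gen)

lemma osq_in_Omega1: "\<forall>X\<in>Omega1 \<iota>. osq X \<in> Omega1 \<iota>"
  by (simp add: lift_kcls)

end

theorem mainTheorem2:
  fixes \<iota> :: "'k::field \<Rightarrow> 'a::comm_ring_1"
    and P :: "'a \<Rightarrow> 'a \<Rightarrow> 'a"
    and S :: "'a \<Rightarrow> 'a"
  assumes "CHAR('k) = 2"
    and "restricted_poisson_algebra \<iota> P S"
    and "Omega1_free \<iota>"
  shows "\<exists>sq. (\<forall>X\<in>Omega1 \<iota>. sq X \<in> Omega1 \<iota>) \<and>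
    (\<forall>x u. sq (odiff \<iota> x u) = oadd \<iota> (odiff \<iota> (x^2) (S u)) (odiff \<iota> (x * P u x) u)) \<and>
    restricted_lie_algebra_on (Omega1 \<iota>) (oadd \<iota>) (ozero \<iota>) (oneg \<iota>)
       (\<lambda>c X. osmul \<iota> (\<iota> c) X) (obr \<iota> P) sq \<and>
    restricted_lie_rinehart \<iota> (Omega1 \<iota>) (oadd \<iota>) (ozero \<iota>) (oneg \<iota>) (osmul \<iota>)
       (obr \<iota> P) sq (anchor P)"
proof -
  have "k_algebra \<iota>"
    using assms(2) by (simp add: restricted_poisson_algebra_def)
  then obtain p :: "('a \<Rightarrow> 'a) \<Rightarrow> 'a \<Rightarrow> 'a" where p: "\<forall>f g. p (f + g) = p f + p g"
    "\<forall>f. p f = 0 \<longleftrightarrow> f \<in> kahler_rel \<iota>"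
    using exists_projection_with_kernel_kahler_rel by blast
  \<comment> \<open>A well-order supplies a total order on the symbols; removing its diagonal makes
    it strict.\<close>
  obtain r :: "'a rel" where r: "Well_order r" "Field r = UNIV"
    using well_ordering[where 'a = 'a] by (elim exE conjE)
  have "total r" "antisym r"
    using r by (simp_all add: order_on_defs)
  then have r': "(u, v) \<in> r - Id \<longleftrightarrow> (v, u) \<notin> r - Id" if "u \<noteq> v" for u v
    using that by (auto simp: total_on_def dest: antisymD)
  interpret restricted_poisson_char_2 \<iota> P S p "r - Id"
  proof (rule restricted_poisson_char_2.intro)
    show "p (f + g) = p f + p g" for f g using p(1) by (elim allE)
    show "p f = 0 \<longleftrightarrow> f \<in> kahler_rel \<iota>" for f using p(2) by (elim allE)
    show "(u, u) \<notin> r - Id" for u by simp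
    show "(u, v) \<in> r - Id \<longleftrightarrow> (v, u) \<notin> r - Id" if "u \<noteq> v" for u v by (rule r'[OF that])
  qed (rule assms)+
  show ?thesis
    by (intro exI[of _ osq] conjI allI osq_in_Omega1 osq_odiff
        restricted_lie_algebra_on_Omega1 restricted_lie_rinehart_Omega1)
qed

end
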